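(* For any ring $R$, the family $$\mathcal{F}=\{I \text{ an ideal of } R : \text{for all ideals } X,Y \text{ of } R,\ XIY=0\implies XY=0\}$$ satisfies $(P_1)$. Moreover, an ideal of $R$ that is maximal (under inclusion) among the middle annihilators of $R$ is prime.
   Context: Rings are associative and unital, not necessarily commutative; "ideal" means two-sided ideal. For ideals $X,Y$ of $R$, $\operatorname{ann}(X,Y)=\{r\in R : XrY=0\}$, which is an ideal of $R$. Such an ideal $\operatorname{ann}(X,Y)$ is called a middle annihilator of $R$ if $XY\neq 0$. A family $\mathcal{F}$ of ideals of $R$ satisfies $(P_1)$ if $R\in\mathcal{F}$, $\mathcal{F}$ is closed under products ($I,J\in\mathcal{F}\Rightarrow IJ\in\mathcal{F}$), and $\mathcal{F}$ is upward closed ($I\in\mathcal{F}$ and $J\supseteq I$ an ideal imply $J\in\mathcal{F}$). *)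

theory Defs
  imports "HOL-Algebra.Ideal_Product"
begin

text \<open>
  Rings are those of the locale \<open>ring\<close>: associative and unital, not necessarily commutative,
  the zero ring included. In \<open>ideal_prod R X Y = {\<zero>\<^bsub>R\<^esub>}\<close> the left-hand side is the usual
  product of ideals (all finite sums of products).
\<close>

definition ann :: "('a, 'b) ring_scheme \<Rightarrow> 'a set \<Rightarrow> 'a set \<Rightarrow> 'a set"
  where "ann R X Y =
    {r \<in> carrier R. \<forall>x\<in>X. \<forall>y\<in>Y. x \<otimes>\<^bsub>R\<^esub> r \<otimes>\<^bsub>R\<^esub> y = \<zero>\<^bsub>R\<^esub>}"

definition middle_annihilators :: "('a, 'b) ring_scheme \<Rightarrow> 'a set set"
  where "middle_annihilators R =
    {ann R X Y | X Y. ideal X R \<and> ideal Y R \<and> ideal_prod R X Y \<noteq> {\<zero>\<^bsub>R\<^esub>}}"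

definition satisfies_P1 :: "('a, 'b) ring_scheme \<Rightarrow> 'a set set \<Rightarrow> bool"
  where "satisfies_P1 R \<F> \<longleftrightarrow>
    \<F> \<subseteq> {I. ideal I R} \<and>
    carrier R \<in> \<F> \<and>
    (\<forall>I\<in>\<F>. \<forall>J\<in>\<F>. ideal_prod R I J \<in> \<F>) \<and>
    (\<forall>I\<in>\<F>. \<forall>J. ideal J R \<and> I \<subseteq> J \<longrightarrow> J \<in> \<F>)"

text \<open>
  The locale \<open>primeideal\<close> presupposes a commutative ring and tests elements; over
  noncommutative rings primeness is a condition on products of two-sided ideals.
\<close>

definition nc_prime_ideal :: "'a set \<Rightarrow> ('a, 'b) ring_scheme \<Rightarrow> bool"
  where "nc_prime_ideal P R \<longleftrightarrow>
    ideal P R \<and> P \<noteq> carrier R \<and>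
    (\<forall>I J. ideal I R \<and> ideal J R \<and> ideal_prod R I J \<subseteq> P \<longrightarrow> I \<subseteq> P \<or> J \<subseteq> P)"

end

theory Submission
  imports Defs
begin

text \<open>
  For ideals \<open>X\<close>, \<open>I\<close>, \<open>Y\<close> we have \<open>XIY = 0\<close> iff \<open>I \<subseteq> ann(X,Y)\<close>; associativity of the product
  of ideals does the rest. In particular, let \<open>P = ann(X,Y)\<close> be a maximal middle annihilator and
  let \<open>IJ \<subseteq> P\<close> with \<open>I\<close> not contained in \<open>P\<close>. Then \<open>XIY \<noteq> 0\<close>, so \<open>ann(XI,Y)\<close> is a middle annihilator;
  it contains \<open>P\<close>, hence equals \<open>P\<close>, and it contains \<open>J\<close>.
\<close>

context ring
begin

text \<open>The product of two ideals is additively generated by the products of their elements, so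
  it vanishes once these generators do. This links equations between ideals to the elementwise
  definition of \<open>ann\<close>.\<close>

lemma ideal_prod_eq_zero_iff:
  assumes "ideal I R" "ideal J R"
  shows "I \<cdot> J = {\<zero>} \<longleftrightarrow> (\<forall>i\<in>I. \<forall>j\<in>J. i \<otimes> j = \<zero>)"
proof
  assume "I \<cdot> J = {\<zero>}"
  then show "\<forall>i\<in>I. \<forall>j\<in>J. i \<otimes> j = \<zero>"
    using ideal_prod.prod[of _ I _ J R] by auto
next
  assume zero: "\<forall>i\<in>I. \<forall>j\<in>J. i \<otimes> j = \<zero>"
  have "s = \<zero>" if "s \<in> I \<cdot> J" for s
    using that by induct (simp_all add: zero)
  moreover have "\<zero> \<in> I \<cdot> J"
    using ideal_prod_is_ideal[OF assms] by (simp add: additive_subgroup.zero_closed ideal.axioms(1))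
  ultimately show "I \<cdot> J = {\<zero>}" by blast
qed

text \<open>Additive closure is distributivity. A multiplier \<open>r\<close> from the ring is
  absorbed by the neighbouring ideal: \<open>x \<otimes> r\<close> stays in \<open>X\<close> and
  \<open>r \<otimes> y\<close> stays in \<open>Y\<close>.\<close>

lemma ann_is_ideal:
  assumes X: "ideal X R" and Y: "ideal Y R"
  shows "ideal (ann R X Y) R"
proof (rule idealI[OF ring_axioms])
  have carr: "x \<in> carrier R" "y \<in> carrier R" if "x \<in> X" "y \<in> Y" for x y
    using that ideal.Icarr[OF X] ideal.Icarr[OF Y] by auto
  show "subgroup (ann R X Y) (add_monoid R)"
  proof (rule add.subgroupI)
    show "ann R X Y \<subseteq> carrier R" by (auto simp: ann_def)
    have "\<zero> \<in> ann R X Y" by (auto simp: ann_def carr)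
    then show "ann R X Y \<noteq> {}" by blast
    show "\<ominus> a \<in> ann R X Y" if "a \<in> ann R X Y" for a
      using that by (auto simp: ann_def carr r_minus l_minus)
    show "a \<oplus> b \<in> ann R X Y" if "a \<in> ann R X Y" "b \<in> ann R X Y" for a b
      using that by (auto simp: ann_def carr r_distr l_distr)
  qed
  fix a r assume a: "a \<in> ann R X Y" and r: "r \<in> carrier R"
  have a_carr: "a \<in> carrier R" using a by (simp add: ann_def)
  show "r \<otimes> a \<in> ann R X Y"
    unfolding ann_def
  proof (intro CollectI conjI ballI)
    fix x y assume xy: "x \<in> X" "y \<in> Y"
    have "x \<otimes> (r \<otimes> a) \<otimes> y = (x \<otimes> r) \<otimes> a \<otimes> y"
      by (simp add: m_assoc carr[OF xy] a_carr r)
    also have "\<dots> = \<zero>"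
      using a xy ideal.I_r_closed[OF X xy(1) r] by (simp add: ann_def)
    finally show "x \<otimes> (r \<otimes> a) \<otimes> y = \<zero>" .
  qed (simp add: a_carr r)
  show "a \<otimes> r \<in> ann R X Y"
    unfolding ann_def
  proof (intro CollectI conjI ballI)
    fix x y assume xy: "x \<in> X" "y \<in> Y"
    have "x \<otimes> (a \<otimes> r) \<otimes> y = x \<otimes> a \<otimes> (r \<otimes> y)"
      by (simp add: m_assoc carr[OF xy] a_carr r)
    also have "\<dots> = \<zero>"
      using a xy ideal.I_l_closed[OF Y xy(2) r] by (simp add: ann_def)
    finally show "x \<otimes> (a \<otimes> r) \<otimes> y = \<zero>" .
  qed (simp add: a_carr r)
qed

lemma subset_ann_iff:
  assumes X: "ideal X R" and I: "ideal I R" and Y: "ideal Y R"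
  shows "I \<subseteq> ann R X Y \<longleftrightarrow> X \<cdot> I \<cdot> Y = {\<zero>}"
proof
  assume sub: "I \<subseteq> ann R X Y"
  \<comment> \<open>The definition of \<open>ann\<close> covers only
    \<open>s = x \<otimes> i\<close>; induction over the sums that make up
    \<open>X \<cdot> I\<close> extends it to every \<open>s\<close>.\<close>
  have "s \<otimes> y = \<zero>" if "s \<in> X \<cdot> I" and y: "y \<in> Y" for s y
    using that(1)
  proof induct
    case (prod x i)
    then show ?case using sub y by (auto simp: ann_def)
  next
    case (sum s t)
    moreover have "s \<in> carrier R" "t \<in> carrier R"
      using sum ideal_prod_in_carrier[OF X I] by auto
    ultimately show ?case
      using ideal.Icarr[OF Y y] by (simp add: l_distr)
  qed
  then show "X \<cdot> I \<cdot> Y = {\<zero>}"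
    by (simp add: ideal_prod_eq_zero_iff[OF ideal_prod_is_ideal[OF X I] Y])
next
  assume "X \<cdot> I \<cdot> Y = {\<zero>}"
  then have "s \<otimes> y = \<zero>" if "s \<in> X \<cdot> I" "y \<in> Y" for s y
    using that by (simp add: ideal_prod_eq_zero_iff[OF ideal_prod_is_ideal[OF X I] Y])
  then show "I \<subseteq> ann R X Y"
    using ideal.Icarr[OF I] by (auto simp: ann_def intro: ideal_prod.prod)
qed

text \<open>This is the case \<open>I = carrier R\<close> of \<open>subset_ann_iff\<close>, since
  \<open>X \<cdot> carrier R = X\<close>. It makes middle annihilators proper ideals.\<close>

lemma ann_eq_carrier_iff:
  assumes "ideal X R" "ideal Y R"
  shows "ann R X Y = carrier R \<longleftrightarrow> X \<cdot> Y = {\<zero>}"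
proof -
  have "ann R X Y = carrier R \<longleftrightarrow> carrier R \<subseteq> ann R X Y"
    by (auto simp: ann_def)
  also have "\<dots> \<longleftrightarrow> X \<cdot> Y = {\<zero>}"
    by (simp add: subset_ann_iff assms oneideal ideal_prod_one)
  finally show ?thesis .
qed

text \<open>Both sides say that the fourfold product of \<open>X\<close>, \<open>I\<close>,
  \<open>J\<close>, \<open>Y\<close> is zero, bracketed differently.\<close>

lemma subset_ann_ideal_prod_iff:
  assumes "ideal X R" "ideal I R" "ideal J R" "ideal Y R"
  shows "J \<subseteq> ann R (X \<cdot> I) Y \<longleftrightarrow> I \<cdot> J \<subseteq> ann R X Y"
  by (simp add: assms subset_ann_iff ideal_prod_is_ideal ideal_prod_assoc)

lemma satisfies_P1_middle_regular:
  "satisfies_P1 R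
     {I. ideal I R \<and>
         (\<forall>X Y. ideal X R \<and> ideal Y R \<longrightarrow> X \<cdot> I \<cdot> Y = {\<zero>} \<longrightarrow> X \<cdot> Y = {\<zero>})}"
    (is "satisfies_P1 R ?F")
  unfolding satisfies_P1_def
proof (intro conjI ballI allI impI)
  show "?F \<subseteq> {I. ideal I R}" by blast
  show "carrier R \<in> ?F" by (simp add: oneideal ideal_prod_one)
next
  fix I J assume "I \<in> ?F" and "J \<in> ?F"
  then have I: "ideal I R" and J: "ideal J R"
    and I_cancel: "\<And>X Y. ideal X R \<Longrightarrow> ideal Y R \<Longrightarrow> X \<cdot> I \<cdot> Y = {\<zero>} \<Longrightarrow> X \<cdot> Y = {\<zero>}"
    and J_cancel: "\<And>X Y. ideal X R \<Longrightarrow> ideal Y R \<Longrightarrow> X \<cdot> J \<cdot> Y = {\<zero>} \<Longrightarrow> X \<cdot> Y = {\<zero>}"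
    by blast+
  have "X \<cdot> Y = {\<zero>}" if X: "ideal X R" and Y: "ideal Y R" and "X \<cdot> (I \<cdot> J) \<cdot> Y = {\<zero>}" for X Y
  proof (rule I_cancel[OF X Y])
    \<comment> \<open>After regrouping, \<open>J\<close> is cancelled first, with
      \<open>X \<cdot> I\<close> as the left ideal; cancelling \<open>I\<close> then
      remains.\<close>
    have "(X \<cdot> I) \<cdot> J \<cdot> Y = {\<zero>}"
      using that(3) by (simp only: ideal_prod_assoc[OF X I J])
    then show "X \<cdot> I \<cdot> Y = {\<zero>}"
      by (rule J_cancel[OF ideal_prod_is_ideal[OF X I] Y])
  qed
  then show "I \<cdot> J \<in> ?F"
    using ideal_prod_is_ideal[OF I J] by blast
next
  fix I J assume "I \<in> ?F" and "ideal J R \<and> I \<subseteq> J"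
  then have I: "ideal I R" and J: "ideal J R" and IJ: "I \<subseteq> J"
    and I_cancel: "\<And>X Y. ideal X R \<Longrightarrow> ideal Y R \<Longrightarrow> X \<cdot> I \<cdot> Y = {\<zero>} \<Longrightarrow> X \<cdot> Y = {\<zero>}"
    by blast+
  have "X \<cdot> Y = {\<zero>}" if X: "ideal X R" and Y: "ideal Y R" and "X \<cdot> J \<cdot> Y = {\<zero>}" for X Y
  proof (rule I_cancel[OF X Y])
    \<comment> \<open>Read as containment in \<open>ann R X Y\<close>, the vanishing of the triple
      product passes from \<open>J\<close> to the smaller ideal \<open>I\<close>.\<close>
    have "I \<subseteq> ann R X Y"
      using that(3) IJ subset_ann_iff[OF X J Y] by blast
    then show "X \<cdot> I \<cdot> Y = {\<zero>}"
      using subset_ann_iff[OF X I Y] by blast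
  qed
  then show "J \<in> ?F"
    using J by blast
qed

lemma maximal_middle_annihilator_prime:
  assumes P: "P \<in> middle_annihilators R"
    and max: "\<And>Q. Q \<in> middle_annihilators R \<Longrightarrow> P \<subseteq> Q \<Longrightarrow> Q = P"
  shows "nc_prime_ideal P R"
proof -
  obtain X Y where X: "ideal X R" and Y: "ideal Y R" and XY: "X \<cdot> Y \<noteq> {\<zero>}"
    and P_eq: "P = ann R X Y"
    using P by (auto simp: middle_annihilators_def)
  have P_ideal: "ideal P R"
    unfolding P_eq by (rule ann_is_ideal[OF X Y])
  have "J \<subseteq> P" if I: "ideal I R" and J: "ideal J R" and IJ: "I \<cdot> J \<subseteq> P" and nI: "\<not> I \<subseteq> P" for I J
  proof -
    have "X \<cdot> I \<cdot> Y \<noteq> {\<zero>}"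
      using nI subset_ann_iff[OF X I Y] by (simp add: P_eq)
    then have "ann R (X \<cdot> I) Y \<in> middle_annihilators R"
      using ideal_prod_is_ideal[OF X I] Y by (auto simp: middle_annihilators_def)
    \<comment> \<open>This amounts to \<open>I \<cdot> P \<subseteq> P\<close>, which holds because
      \<open>P\<close> is an ideal.\<close>
    moreover have "P \<subseteq> ann R (X \<cdot> I) Y"
      using ideal_prod_inter[OF I P_ideal] subset_ann_ideal_prod_iff[OF X I P_ideal Y]
      by (simp add: P_eq)
    ultimately have "ann R (X \<cdot> I) Y = P"
      by (rule max)
    then show ?thesis
      using IJ subset_ann_ideal_prod_iff[OF X I J Y] by (simp add: P_eq)
  qed
  then show ?thesis
    \<comment> \<open>Properness of \<open>P\<close> comes from \<open>X \<cdot> Y\<close> being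
      nonzero.\<close>
    using P_ideal XY ann_eq_carrier_iff[OF X Y] by (auto simp: nc_prime_ideal_def P_eq)
qed

end

theorem proposition3p7:
  fixes R :: "('a, 'b) ring_scheme"
  assumes "ring R"
  shows "satisfies_P1 R
           {I. ideal I R \<and>
               (\<forall>X Y. ideal X R \<and> ideal Y R \<longrightarrow>
                  ideal_prod R (ideal_prod R X I) Y = {\<zero>\<^bsub>R\<^esub>} \<longrightarrow>
                  ideal_prod R X Y = {\<zero>\<^bsub>R\<^esub>})}
         \<and> (\<forall>P \<in> middle_annihilators R.
              (\<forall>Q \<in> middle_annihilators R. P \<subseteq> Q \<longrightarrow> Q = P) \<longrightarrow>
              nc_prime_ideal P R)"
proof -
  interpret ring R by fact
  show ?thesis
    by (intro conjI ballI impI satisfies_P1_middle_regular maximal_middle_annihilator_prime) auto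
qed

end
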